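(* Let $\mathcal S=I_0+I_1\lambda+\cdots+I_{n-1}\lambda^{n-1}+\lambda^n$, $I_j=[a_j,b_j]$, be a monic interval polynomial. If some polynomial $P_o\in\mathcal S$ is $q$-unstable and, for every $\omega\ge0$, $$\Big(\mathrm{Re}(g_1(\mathcal S,i\omega))\cdot\mathrm{Re}(g_2(\mathcal S,i\omega))\,,\ \mathrm{Im}(h_1(\mathcal S,i\omega))\cdot\mathrm{Im}(h_2(\mathcal S,i\omega))\Big)\notin\{(x,y)\in\mathbb R^2:x\le0,\ y\le0\},$$ then the interval polynomial $\mathcal S$ is $q$-unstable.
   Context: **Interval polynomials.** The interval polynomial $\mathcal S=I_0+I_1\lambda+\cdots+I_{n-1}\lambda^{n-1}+\lambda^n$ with compact real intervals $I_j=[a_j,b_j]$ is the set of all polynomials $c_0+c_1\lambda+\cdots+c_{n-1}\lambda^{n-1}+\lambda^n$ with $c_j\in I_j$ for all $j$; the leading coefficient is $1$, i.e. $a_n=b_n=1$. **$q$-instability.** A monic real polynomial of degree $n$ is $q$-unstable if it has exactly $q$ roots with positive real part and $n-q$ roots with negative real part (with multiplicities). A monic interval polynomial $\mathcal S$ is $q$-unstable if every $P\in\mathcal S$ is $q$-unstable. **Corner polynomials** (lower and upper endpoints alternate; sums run up to degree $n$): $g_1(\mathcal S,\lambda)=a_0+b_2\lambda^2+a_4\lambda^4+\cdots$; $g_2(\mathcal S,\lambda)=b_0+a_2\lambda^2+b_4\lambda^4+\cdots$; $h_1(\mathcal S,\lambda)=a_1\lambda+b_3\lambda^3+a_5\lambda^5+\cdots$;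 $h_2(\mathcal S,\lambda)=b_1\lambda+a_3\lambda^3+b_5\lambda^5+\cdots$. *)

theory Defs
  imports "HOL-Analysis.Analysis" "HOL-Computational_Algebra.Computational_Algebra"
begin

definition interval_poly :: "nat \<Rightarrow> (nat \<Rightarrow> real) \<Rightarrow> (nat \<Rightarrow> real) \<Rightarrow> real poly set" where
  "interval_poly n a b =
     {(\<Sum>j<n. monom (c j) j) + monom 1 n | c. \<forall>j<n. c j \<in> {a j..b j}}"

definition q_unstable :: "nat \<Rightarrow> real poly \<Rightarrow> bool" where
  "q_unstable q P \<longleftrightarrow> lead_coeff P = 1 \<and>
     size (filter_mset (\<lambda>z. Re z > 0) (proots (map_poly complex_of_real P))) = q \<and>
     size (filter_mset (\<lambda>z. Re z < 0) (proots (map_poly complex_of_real P))) = degree P - q"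
  (* The subtraction never truncates: the first count forces q \<le> degree P. *)

definition q_unstable_interval :: "nat \<Rightarrow> real poly set \<Rightarrow> bool" where
  "q_unstable_interval q S \<longleftrightarrow> (\<forall>P\<in>S. q_unstable q P)"

(* The corner polynomials also use the endpoints of index n, so for a monic interval
   polynomial they are to be read with a n = b n = 1. *)

definition corner_g1 :: "nat \<Rightarrow> (nat \<Rightarrow> real) \<Rightarrow> (nat \<Rightarrow> real) \<Rightarrow> real poly" where
  "corner_g1 n a b =
     (\<Sum>k | 2 * k \<le> n. monom (if even k then a (2 * k) else b (2 * k)) (2 * k))"

definition corner_g2 :: "nat \<Rightarrow> (nat \<Rightarrow> real) \<Rightarrow> (nat \<Rightarrow> real) \<Rightarrow> real poly" where
  "corner_g2 n a b =
     (\<Sum>k | 2 * k \<le> n. monom (if even k then b (2 * k) else a (2 * k)) (2 * k))"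

definition corner_h1 :: "nat \<Rightarrow> (nat \<Rightarrow> real) \<Rightarrow> (nat \<Rightarrow> real) \<Rightarrow> real poly" where
  "corner_h1 n a b =
     (\<Sum>k | 2 * k + 1 \<le> n. monom (if even k then a (2 * k + 1) else b (2 * k + 1)) (2 * k + 1))"

definition corner_h2 :: "nat \<Rightarrow> (nat \<Rightarrow> real) \<Rightarrow> (nat \<Rightarrow> real) \<Rightarrow> real poly" where
  "corner_h2 n a b =
     (\<Sum>k | 2 * k + 1 \<le> n. monom (if even k then b (2 * k + 1) else a (2 * k + 1)) (2 * k + 1))"

definition eval_imag_axis :: "real poly \<Rightarrow> real \<Rightarrow> complex" where
  "eval_imag_axis p \<omega> = poly (map_poly complex_of_real p) (\<i> * complex_of_real \<omega>)"

end

theory Submission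
  imports Defs
begin

text \<open>
  The values at \<open>\<i>\<omega>\<close> (with \<open>\<omega> \<ge> 0\<close>) of the even and the odd part of a member of the family lie
  between those of the corner polynomials, so the hypothesis keeps the imaginary axis free of roots
  for every member. Joining \<open>Po\<close> to another member by a segment, the number of roots in the right
  half plane stays constant: the parameters for which the roots can be listed with \<open>k\<close> of them in the
  closed right half plane and the others in the closed left half plane form the projection of a
  compact set of pairs (parameter, root tuple). These finitely many closed sets are pairwise
  disjoint and cover the connected segment.
\<close>

section \<open>Continuity of the root count\<close>

definition monic_poly :: "nat \<Rightarrow> (nat \<Rightarrow> 'a::comm_ring_1) \<Rightarrow> 'a poly" where
  "monic_poly n c = (\<Sum>j<n. monom (c j) j) + monom 1 n"

definition rhp_count :: "complex poly \<Rightarrow> nat" where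
  "rhp_count p = size (filter_mset (\<lambda>z. Re z > 0) (proots p))"

lemma coeff_monic_poly:
  "coeff (monic_poly n c) i = (if i < n then c i else if i = n then 1 else 0)"
  by (simp add: monic_poly_def coeff_sum)

lemma degree_monic_poly [simp]: "degree (monic_poly n c) = n"
  by (rule antisym) (auto intro: degree_le le_degree simp: coeff_monic_poly)

lemma lead_coeff_monic_poly [simp]: "lead_coeff (monic_poly n c) = 1"
  by (simp add: coeff_monic_poly)

lemma monic_poly_nonzero [simp]: "monic_poly n c \<noteq> 0"
  using lead_coeff_monic_poly[of n c] by (metis leading_coeff_0_iff zero_neq_one)

lemma poly_monic_poly: "poly (monic_poly n c) x = (\<Sum>j<n. c j * x ^ j) + x ^ n"
  by (simp add: monic_poly_def poly_sum poly_monom)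

lemma map_poly_monic_poly:
  "map_poly complex_of_real (monic_poly n c) = monic_poly n (\<lambda>j. complex_of_real (c j))"
  by (rule poly_eqI) (simp add: coeff_map_poly coeff_monic_poly)

text \<open>A Cauchy-type bound: if \<open>norm z > 1\<close>, each lower term is at most
  \<open>B j * norm z ^ (n - 1)\<close>, and this power cancels. The bound depends on
  \<open>B\<close> only, so one ball serves a whole family of coefficients.\<close>

lemma norm_root_monic_poly_le:
  assumes "poly (monic_poly n c) (z::complex) = 0" "\<And>j. j < n \<Longrightarrow> norm (c j) \<le> B j"
  shows "norm z \<le> 1 + (\<Sum>j<n. B j)"
proof (cases "norm z \<le> 1")
  case True
  have "0 \<le> (\<Sum>j<n. B j)"
    by (rule sum_nonneg) (metis assms(2) lessThan_iff norm_ge_zero order_trans)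
  with True show ?thesis by simp
next
  case False
  then have z: "norm z > 1" by simp
  have "n > 0"
  proof (rule ccontr)
    assume "\<not> n > 0"
    then show False using assms(1) by (simp add: poly_monic_poly)
  qed
  have "norm z * norm z ^ (n - 1) = norm (z ^ n)"
    using \<open>n > 0\<close> by (cases n) (simp_all add: norm_mult norm_power)
  also have "z ^ n = - (\<Sum>j<n. c j * z ^ j)"
    using assms(1) by (simp only: poly_monic_poly add_eq_0_iff)
  also have "norm \<dots> \<le> (\<Sum>j<n. norm (c j * z ^ j))"
    by (simp add: norm_sum)
  also have "\<dots> \<le> (\<Sum>j<n. B j * norm z ^ (n - 1))"
  proof (rule sum_mono)
    fix j assume j: "j \<in> {..<n}"
    have "norm z ^ j \<le> norm z ^ (n - 1)"
      using z j by (intro power_increasing) auto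
    moreover have "0 \<le> B j" using assms(2)[of j] j by (meson lessThan_iff norm_ge_zero order_trans)
    ultimately show "norm (c j * z ^ j) \<le> B j * norm z ^ (n - 1)"
      using assms(2)[of j] j by (auto simp: norm_mult norm_power intro!: mult_mono)
  qed
  also have "\<dots> = (\<Sum>j<n. B j) * norm z ^ (n - 1)"
    by (simp add: sum_distrib_right)
  finally have "norm z \<le> (\<Sum>j<n. B j)"
    by (rule mult_right_le_imp_le) (use z in \<open>intro zero_less_power, linarith\<close>)
  then show ?thesis by simp
qed

section \<open>Linear factors and ordered root tuples\<close>

lemma proots_prod_linear:
  fixes n :: nat
  shows "proots (\<Prod>j<n. [:- z j, 1:]) = image_mset z (mset_set {..<n})"
proof (induction n)
  case (Suc n)
  have "proots (\<Prod>j<Suc n. [:- z j, 1:]) = proots (\<Prod>j<n. [:- z j, 1:]) + proots [:- z n, 1:]"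
    by (simp add: proots_mult del: proots_linear_factor mult_pCons_right)
  with Suc show ?case by (simp add: lessThan_Suc)
qed simp

lemma monic_poly_eq_prod_roots:
  fixes c :: "nat \<Rightarrow> complex"
  shows "monic_poly n c = (\<Prod>x\<in>#proots (monic_poly n c). [:- x, 1:])"
proof -
  obtain A where A: "monic_poly n c = (\<Prod>x\<in>#A. [:- x, 1:])"
    using alg_closed_imp_factorization[of "monic_poly n c"] by (auto simp del: degree_monic_poly)
  \<comment> \<open>Algebraic closedness yields some multiset \<open>A\<close> of linear factors; it
    has to be identified with the multiset of roots.\<close>
  have "proots (\<Prod>x\<in>#A. [:- x, 1:]) = A"
  proof (induction A)
    case (add x A)
    have "(\<Prod>x\<in>#A. [:- x, 1:]) \<noteq> (0 :: complex poly)" by auto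
    then have "proots (\<Prod>x\<in>#add_mset x A. [:- x, 1:]) = proots [:- x, 1:] + proots (\<Prod>x\<in>#A. [:- x, 1:])"
      by (simp add: proots_mult del: proots_linear_factor mult_pCons_left)
    with add show ?case by simp
  qed simp
  with A show ?thesis by metis
qed

text \<open>The roots with positive real part are listed first. The tuple is a total function on
  nat, so that it is a point of a product space; the last clause serves to bound all its
  entries.\<close>

lemma ordered_root_tuple:
  fixes n :: nat and c :: "nat \<Rightarrow> complex"
  defines "p \<equiv> monic_poly n c"
  obtains z where "p = (\<Prod>j<n. [:- z j, 1:])"
    "\<And>j. j < rhp_count p \<Longrightarrow> Re (z j) > 0" "\<And>j. rhp_count p \<le> j \<Longrightarrow> Re (z j) \<le> 0"
    "\<And>j. z j = 0 \<or> poly p (z j) = 0"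
proof -
  obtain xs where xs: "mset xs = filter_mset (\<lambda>z. Re z > 0) (proots p)" using ex_mset by blast
  obtain ys where ys: "mset ys = filter_mset (\<lambda>z. \<not> Re z > 0) (proots p)" using ex_mset by blast
  have all: "mset (xs @ ys) = proots p"
    using xs ys by (metis mset_append multiset_partition)
  have len: "length (xs @ ys) = n"
    using size_mset[of "xs @ ys"] size_proots_complex[of p] unfolding all by (simp add: p_def)
  have lx: "length xs = rhp_count p"
    unfolding rhp_count_def using xs by (metis size_mset)
  \<comment> \<open>The padding value 0 satisfies \<open>Re (z j) \<le> 0\<close> and lies in every
    ball of nonnegative radius around 0.\<close>
  define z where "z j = (if j < n then (xs @ ys) ! j else 0)" for j
  have "p = (\<Prod>x\<in>#mset (xs @ ys). [:- x, 1:])"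
    unfolding all unfolding p_def by (rule monic_poly_eq_prod_roots)
  also have "\<dots> = prod_list (map (\<lambda>x. [:- x, 1:]) (xs @ ys))"
    by (simp only: mset_map[symmetric] prod_mset_prod_list)
  also have "\<dots> = (\<Prod>j<n. [:- ((xs @ ys) ! j), 1:])"
    using len by (subst prod.list_conv_set_nth)
      (auto simp: atLeast0LessThan simp del: map_append length_append intro!: prod.cong)
  also have "\<dots> = (\<Prod>j<n. [:- z j, 1:])"
    by (rule prod.cong) (auto simp: z_def)
  finally have p: "p = (\<Prod>j<n. [:- z j, 1:])" .
  have pos: "Re x > 0" if "x \<in> set xs" for x
    using that xs by (metis (mono_tags, lifting) mem_Collect_eq set_mset_filter set_mset_mset)
  have neg: "Re x \<le> 0" if "x \<in> set ys" for x
    using that ys by (metis (mono_tags, lifting) mem_Collect_eq not_le set_mset_filter set_mset_mset)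
  show ?thesis
  proof
    show "Re (z j) > 0" if "j < rhp_count p" for j
      using that lx len by (auto simp: z_def nth_append intro!: pos)
    show "Re (z j) \<le> 0" if "rhp_count p \<le> j" for j
      using that lx len by (auto simp: z_def nth_append intro!: neg)
    show "z j = 0 \<or> poly p (z j) = 0" for j
      by (cases "j < n") (auto simp: p poly_prod z_def)
  qed (rule p)
qed

text \<open>Only weak inequalities on the real parts survive in limits of tuples. Since no root lies
  on the imaginary axis, they are strict for the actual roots, and the count is recovered.\<close>

lemma rhp_count_prod_linear:
  assumes "p = (\<Prod>j<n. [:- z j, 1:])" "k \<le> n"
    and "\<And>j. j < k \<Longrightarrow> Re (z j) \<ge> 0" "\<And>j. k \<le> j \<Longrightarrow> Re (z j) \<le> 0"
    and "\<And>w. poly p w = 0 \<Longrightarrow> Re w \<noteq> 0"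
  shows "rhp_count p = k"
proof -
  have nz: "Re (z j) \<noteq> 0" if "j < n" for j
    using that by (intro assms(5)) (auto simp: assms(1) poly_prod)
  have "rhp_count p = card {j\<in>{..<n}. Re (z j) > 0}"
    by (simp add: rhp_count_def assms(1) proots_prod_linear filter_mset_image_mset)
  also have "{j\<in>{..<n}. Re (z j) > 0} = {..<k}"
  proof (intro set_eqI iffI)
    fix j assume "j \<in> {j\<in>{..<n}. Re (z j) > 0}"
    then show "j \<in> {..<k}" using assms(4)[of j] by force
  next
    fix j assume "j \<in> {..<k}"
    then show "j \<in> {j\<in>{..<n}. Re (z j) > 0}" using assms(2) assms(3)[of j] nz[of j] by force
  qed
  finally show ?thesis by simp
qed

section \<open>Compactness and the level sets of the root count\<close>

lemma compact_Pi_UNIV: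
  assumes "\<And>i. compact (S i)"
  shows "compact (Pi UNIV S)"
  \<comment> \<open>Tychonoff's theorem; the topology of a function type is the product
    topology.\<close>
  using compactin_PiE[of "\<lambda>_. euclidean" UNIV S] assms
  by (simp add: euclidean_product_topology PiE_UNIV_domain)

lemma closed_Pi_UNIV:
  assumes "\<And>i. closed (S i)"
  shows "closed (Pi UNIV S)"
proof -
  have "Pi UNIV S = (\<Inter>i. {f. f i \<in> S i})" by auto
  moreover have "closed {f. f i \<in> S i}" for i
    using closed_vimage[OF assms, of "\<lambda>f. f i" i] by (simp add: vimage_def)
  ultimately show ?thesis by (simp add: closed_INT)
qed

lemma rhp_count_le: "rhp_count (monic_poly n c) \<le> n"
  unfolding rhp_count_def
  using size_filter_mset_lesseq[of "\<lambda>z. Re z > 0" "proots (monic_poly n c)"]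
  by (simp add: size_proots_complex)

lemma closed_rhp_count_level:
  fixes c :: "'a::t2_space \<Rightarrow> nat \<Rightarrow> complex"
  assumes T: "compact T" and cont: "\<And>j. continuous_on T (\<lambda>t. c t j)"
    and nz: "\<And>t w. t \<in> T \<Longrightarrow> poly (monic_poly n (c t)) w = 0 \<Longrightarrow> Re w \<noteq> 0"
    and "k \<le> n"
  shows "closed {t\<in>T. rhp_count (monic_poly n (c t)) = k}"
proof -
  have "\<exists>B. \<forall>t\<in>T. norm (c t j) \<le> B" for j
    using compact_imp_bounded[OF compact_continuous_image[OF cont T]]
    by (auto simp: bounded_iff)
  then obtain B where B: "\<And>j t. t \<in> T \<Longrightarrow> norm (c t j) \<le> B j" by metis
  \<comment> \<open>The maximum with 0 keeps the padding entries of a root tuple inside the ball,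
    even where no root gives a bound.\<close>
  define R where "R = max 0 (1 + (\<Sum>j<n. B j))"
  define Q :: "(nat \<Rightarrow> complex) set" where "Q = Pi UNIV (\<lambda>_. cball 0 R)"
  have TQ: "compact (T \<times> Q)"
    unfolding Q_def by (intro compact_Times T compact_Pi_UNIV compact_cball)
  \<comment> \<open>The factorization is stated pointwise in \<open>x\<close> and the signs weakly,
    so that \<open>K\<close> is an intersection of closed conditions \<open>K1 x\<close> and
    \<open>K2 j\<close>, each involving finitely many coordinates.\<close>
  define K where "K = {y \<in> T \<times> Q.
    (\<forall>x. poly (monic_poly n (c (fst y))) x = (\<Prod>j<n. x - snd y j)) \<and>
    (\<forall>j. if j < k then 0 \<le> Re (snd y j) else Re (snd y j) \<le> 0)}"
  define K1 where "K1 x = {y \<in> T \<times> Q.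
      poly (monic_poly n (c (fst y))) x - (\<Prod>j<n. x - snd y j) = 0}" for x
  define K2 where "K2 j = {y \<in> T \<times> Q. if j < k then 0 \<le> Re (snd y j) else Re (snd y j) \<le> 0}" for j
  have snd: "continuous_on (T \<times> Q) (\<lambda>y. snd y j)" for j
    by (rule continuous_on_product_then_coordinatewise[OF continuous_on_snd[OF continuous_on_id]])
  have fst: "continuous_on (T \<times> Q) (\<lambda>y. c (fst y) j)" for j
    by (rule continuous_on_compose2[OF cont continuous_on_fst[OF continuous_on_id]]) auto
  have "closed (T \<times> Q)"
    unfolding Q_def by (intro closed_Times compact_imp_closed[OF T] closed_Pi_UNIV closed_cball)
  have K1: "closed (K1 x)" for x
    unfolding K1_def poly_monic_poly
    by (intro continuous_closed_preimage_constant \<open>closed (T \<times> Q)\<close> fst snd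
        continuous_on_diff continuous_on_add continuous_on_sum continuous_on_mult
        continuous_on_prod continuous_on_const)
  have K2: "closed (K2 j)" for j
    unfolding K2_def using \<open>closed (T \<times> Q)\<close>
    by (cases "j < k") (auto intro!: continuous_on_closed_Collect_le continuous_on_Re continuous_on_const snd)
  have "K = (T \<times> Q) \<inter> ((\<Inter>x. K1 x) \<inter> (\<Inter>j. K2 j))"
    by (auto simp: K_def K1_def K2_def)
  also have "compact \<dots>"
    by (intro compact_Int_closed[OF TQ] closed_Int closed_INT ballI K1 K2)
  finally have "closed (fst ` K)"
    by (intro compact_imp_closed compact_continuous_image continuous_on_fst continuous_on_id)
  also have "fst ` K = {t\<in>T. rhp_count (monic_poly n (c t)) = k}"
  proof (intro set_eqI iffI)
    fix t assume "t \<in> fst ` K"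
    then obtain z where z: "(t, z) \<in> K" by force
    then have t: "t \<in> T" by (simp add: K_def)
    have "monic_poly n (c t) = (\<Prod>j<n. [:- z j, 1:])"
      using z by (subst poly_eq_poly_eq_iff[symmetric]) (auto simp: K_def poly_prod)
    moreover have "0 \<le> Re (z j)" if "j < k" for j
      using z that unfolding K_def by (auto dest!: spec[of _ j])
    moreover have "Re (z j) \<le> 0" if "k \<le> j" for j
      using z that unfolding K_def by (auto dest!: spec[of _ j])
    ultimately have "rhp_count (monic_poly n (c t)) = k"
      using \<open>k \<le> n\<close> nz[OF t] by (intro rhp_count_prod_linear)
    with t show "t \<in> {t\<in>T. rhp_count (monic_poly n (c t)) = k}" by simp
  next
    fix t assume t: "t \<in> {t\<in>T. rhp_count (monic_poly n (c t)) = k}"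
    then have k: "rhp_count (monic_poly n (c t)) = k" by simp
    obtain z where z: "monic_poly n (c t) = (\<Prod>j<n. [:- z j, 1:])"
      "\<And>j. j < k \<Longrightarrow> Re (z j) > 0" "\<And>j. k \<le> j \<Longrightarrow> Re (z j) \<le> 0"
      "\<And>j. z j = 0 \<or> poly (monic_poly n (c t)) (z j) = 0"
      using ordered_root_tuple[of n "c t", unfolded k] by blast
    have "norm (z j) \<le> R" for j
      using z(4)[of j] norm_root_monic_poly_le[of n "c t" "z j" B] B t by (auto simp: R_def)
    then have "(t, z) \<in> T \<times> Q" using t by (auto simp: Q_def)
    moreover have "poly (monic_poly n (c t)) x = (\<Prod>j<n. x - z j)" for x
      unfolding z(1) by (simp add: poly_prod)
    ultimately have "(t, z) \<in> K"
      using z(2,3) by (auto simp: K_def intro: less_imp_le)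
    then show "t \<in> fst ` K" by force
  qed
  finally show ?thesis .
qed

lemma rhp_count_constant:
  fixes c :: "'a::t2_space \<Rightarrow> nat \<Rightarrow> complex"
  assumes T: "compact T" "connected T" and cont: "\<And>j. continuous_on T (\<lambda>t. c t j)"
    and nz: "\<And>t w. t \<in> T \<Longrightarrow> poly (monic_poly n (c t)) w = 0 \<Longrightarrow> Re w \<noteq> 0"
    and st: "s \<in> T" "t \<in> T"
  shows "rhp_count (monic_poly n (c s)) = rhp_count (monic_poly n (c t))"
proof -
  let ?f = "\<lambda>t. rhp_count (monic_poly n (c t))"
  define L where "L k = {t\<in>T. ?f t = k}" for k
  have L: "closed (L k)" if "k \<le> n" for k
    unfolding L_def by (rule closed_rhp_count_level[OF T(1) cont nz that])
  \<comment> \<open>The count never exceeds \<open>n\<close>, so all the other levels form a finite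
    union of closed sets. By connectedness this union misses \<open>T\<close>, because the level of
    \<open>s\<close> is nonempty.\<close>
  define B where "B = (\<Union>k\<in>{..n} - {?f s}. L k)"
  have "closed B" unfolding B_def by (intro closed_UN) (auto intro: L)
  moreover have "closed (L (?f s))" by (rule L[OF rhp_count_le])
  moreover have "T \<subseteq> L (?f s) \<union> B" using rhp_count_le by (auto simp: L_def B_def)
  moreover have "L (?f s) \<inter> B \<inter> T = {}" by (auto simp: L_def B_def)
  ultimately have "B \<inter> T = {}"
    using connected_closedD[OF T(2), of "L (?f s)" B] st(1) by (auto simp: L_def)
  with \<open>T \<subseteq> L (?f s) \<union> B\<close> st(2) show ?thesis by (auto simp: L_def)
qed

section \<open>Values on the imaginary axis\<close>

lemma eval_imag_axis_add: "eval_imag_axis (p + q) w = eval_imag_axis p w + eval_imag_axis q w"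
proof -
  have "map_poly complex_of_real (p + q) = map_poly complex_of_real p + map_poly complex_of_real q"
    by (rule poly_eqI) (simp add: coeff_map_poly)
  then show ?thesis by (simp add: eval_imag_axis_def)
qed

lemma eval_imag_axis_sum: "eval_imag_axis (\<Sum>i\<in>A. f i) w = (\<Sum>i\<in>A. eval_imag_axis (f i) w)"
proof (induction A rule: infinite_finite_induct)
  case (insert x A)
  then show ?case by (simp add: eval_imag_axis_add)
qed (simp_all add: eval_imag_axis_def)

lemma eval_imag_axis_monom:
  "eval_imag_axis (monom r j) w = of_real r * (\<i> * of_real w) ^ j"
  by (simp add: eval_imag_axis_def map_poly_monom poly_monom)

text \<open>The sign \<open>(-1) ^ k\<close> comes from the square of the imaginary unit; it is the
  sign that the alternating endpoints of the corner polynomials compensate.\<close>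

lemma eval_imag_axis_monom_even:
  "eval_imag_axis (monom r (2 * k)) w = of_real ((-1) ^ k * r * w ^ (2 * k))"
  by (simp add: eval_imag_axis_monom power_mult power_mult_distrib
      power_minus[of "(complex_of_real w)\<^sup>2"])

lemma eval_imag_axis_monom_odd:
  "eval_imag_axis (monom r (Suc (2 * k))) w = \<i> * of_real ((-1) ^ k * r * w ^ Suc (2 * k))"
  by (simp add: eval_imag_axis_monom power_mult power_mult_distrib
      power_minus[of "(complex_of_real w)\<^sup>2"])

lemma sum_atMost_even_odd:
  fixes f :: "nat \<Rightarrow> 'a::comm_monoid_add"
  shows "(\<Sum>j\<le>n. f j) = (\<Sum>k | 2 * k \<le> n. f (2 * k)) + (\<Sum>k | 2 * k + 1 \<le> n. f (2 * k + 1))"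
proof -
  have "(\<Sum>k | 2 * k \<le> n. f (2 * k)) = (\<Sum>j | j \<le> n \<and> even j. f j)"
    by (rule sum.reindex_bij_witness[of _ "\<lambda>j. j div 2" "\<lambda>k. 2 * k"]) auto
  moreover have "(\<Sum>k | 2 * k + 1 \<le> n. f (2 * k + 1)) = (\<Sum>j | j \<le> n \<and> odd j. f j)"
    by (rule sum.reindex_bij_witness[of _ "\<lambda>j. j div 2" "\<lambda>k. 2 * k + 1"]) (auto elim: oddE)
  moreover have "(\<Sum>j\<le>n. f j) = (\<Sum>j\<in>{j. j \<le> n \<and> even j} \<union> {j. j \<le> n \<and> odd j}. f j)"
    by (rule sum.cong) auto
  ultimately show ?thesis by (subst (asm) sum.union_disjoint) auto
qed

section \<open>Comparison with the corner polynomials\<close>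

lemma monic_poly_atMost: "c n = 1 \<Longrightarrow> monic_poly n c = (\<Sum>j\<le>n. monom (c j) j)"
  by (simp add: monic_poly_def lessThan_Suc_atMost[symmetric])

lemma Re_eval_monic_poly:
  assumes "c n = 1"
  shows "Re (eval_imag_axis (monic_poly n c) w) = (\<Sum>k | 2 * k \<le> n. (-1) ^ k * c (2 * k) * w ^ (2 * k))"
  by (simp only: monic_poly_atMost[of c, OF assms] eval_imag_axis_sum eval_imag_axis_add Re_sum
      sum_atMost_even_odd plus_complex.sel
      eval_imag_axis_monom_even eval_imag_axis_monom_odd Suc_eq_plus1[symmetric])
     (simp del: of_real_mult of_real_power of_real_minus)

lemma Im_eval_monic_poly:
  assumes "c n = 1"
  shows "Im (eval_imag_axis (monic_poly n c) w) =
    (\<Sum>k | 2 * k + 1 \<le> n. (-1) ^ k * c (2 * k + 1) * w ^ (2 * k + 1))"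
  by (simp only: monic_poly_atMost[of c, OF assms] eval_imag_axis_sum eval_imag_axis_add Im_sum
      sum_atMost_even_odd plus_complex.sel
      eval_imag_axis_monom_even eval_imag_axis_monom_odd Suc_eq_plus1[symmetric])
     (simp del: of_real_mult of_real_power of_real_minus)

text \<open>The comparison is termwise: for odd \<open>k\<close> the factor \<open>(-1) ^ k\<close>
  reverses the order, and there \<open>corner_g1\<close> takes the upper endpoint. Even powers of
  \<open>w\<close> are nonnegative for either sign of \<open>w\<close>.\<close>

lemma Re_eval_monic_poly_bounds:
  assumes "c n = 1" "\<And>j. j \<le> n \<Longrightarrow> c j \<in> {a j..b j}"
  shows "Re (eval_imag_axis (monic_poly n c) w)
    \<in> {Re (eval_imag_axis (corner_g1 n a b) w) .. Re (eval_imag_axis (corner_g2 n a b) w)}"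
proof -
  show ?thesis
    unfolding corner_g1_def corner_g2_def eval_imag_axis_sum eval_imag_axis_monom_even
      Re_eval_monic_poly[of c, OF assms(1)] Re_sum Re_complex_of_real atLeastAtMost_iff
    using assms(2) by (intro conjI sum_mono) (auto intro!: mult_right_mono zero_le_even_power)
qed

text \<open>The same termwise comparison, but odd powers of \<open>w\<close> keep the order only for
  \<open>w \<ge> 0\<close>.\<close>

lemma Im_eval_monic_poly_bounds:
  assumes "c n = 1" "\<And>j. j \<le> n \<Longrightarrow> c j \<in> {a j..b j}" "w \<ge> 0"
  shows "Im (eval_imag_axis (monic_poly n c) w)
    \<in> {Im (eval_imag_axis (corner_h1 n a b) w) .. Im (eval_imag_axis (corner_h2 n a b) w)}"
proof -
  have *: "Im (\<i> * complex_of_real r) = r" for r by simp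
  show ?thesis
    unfolding corner_h1_def corner_h2_def eval_imag_axis_sum eval_imag_axis_monom_odd
      Suc_eq_plus1[symmetric]
      Im_eval_monic_poly[of c, OF assms(1)] Im_sum * atLeastAtMost_iff
    using assms(2,3) by (intro conjI sum_mono) (auto intro!: mult_right_mono mult_nonneg_nonneg)
qed

section \<open>Absence of roots on the imaginary axis\<close>

lemma mult_nonpos_of_interval_0:
  fixes x y :: real
  assumes "0 \<in> {x..y}" shows "x * y \<le> 0"
  using assms by (simp add: mult_nonpos_nonneg)

text \<open>At a zero both corner intervals contain 0, so the endpoints of each have a nonpositive
  product, which \<open>corner\<close> excludes.\<close>

lemma eval_imag_axis_nonzero:
  assumes c: "c n = 1" "\<And>j. j \<le> n \<Longrightarrow> c j \<in> {a j..b j}"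
    and corner: "\<And>\<omega>::real. \<omega> \<ge> 0 \<Longrightarrow>
      (Re (eval_imag_axis (corner_g1 n a b) \<omega>) * Re (eval_imag_axis (corner_g2 n a b) \<omega>),
       Im (eval_imag_axis (corner_h1 n a b) \<omega>) * Im (eval_imag_axis (corner_h2 n a b) \<omega>))
      \<notin> {(x, y). x \<le> 0 \<and> y \<le> 0}"
  shows "eval_imag_axis (monic_poly n c) \<omega> \<noteq> 0"
proof
  assume 0: "eval_imag_axis (monic_poly n c) \<omega> = 0"
  \<comment> \<open>The coefficients are real, so conjugation moves a zero at a negative frequency
    to a positive one, where \<open>corner\<close> applies.\<close>
  have "eval_imag_axis (monic_poly n c) (- \<omega>) = cnj (eval_imag_axis (monic_poly n c) \<omega>)"
    by (simp add: eval_imag_axis_def map_poly_monic_poly poly_monic_poly)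
  with 0 have 0: "eval_imag_axis (monic_poly n c) \<bar>\<omega>\<bar> = 0"
    by (cases "\<omega> \<ge> 0") auto
  have "0 \<in> {Re (eval_imag_axis (corner_g1 n a b) \<bar>\<omega>\<bar>) .. Re (eval_imag_axis (corner_g2 n a b) \<bar>\<omega>\<bar>)}"
    using Re_eval_monic_poly_bounds[of c n a b "\<bar>\<omega>\<bar>", OF c] 0 by simp
  moreover have "0 \<in> {Im (eval_imag_axis (corner_h1 n a b) \<bar>\<omega>\<bar>) .. Im (eval_imag_axis (corner_h2 n a b) \<bar>\<omega>\<bar>)}"
    using Im_eval_monic_poly_bounds[of c n a b "\<bar>\<omega>\<bar>", OF c] 0 by simp
  ultimately show False
    using corner[of "\<bar>\<omega>\<bar>"] by (simp add: mult_nonpos_of_interval_0 del: atLeastAtMost_iff)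
qed

lemma imag_axis_root_free:
  assumes "\<And>\<omega>. eval_imag_axis (monic_poly n c) \<omega> \<noteq> 0"
    and "poly (monic_poly n (\<lambda>j. complex_of_real (c j))) w = 0"
  shows "Re w \<noteq> 0"
proof
  assume "Re w = 0"
  then have "\<i> * complex_of_real (Im w) = w" by (simp add: complex_eq_iff)
  with assms(2) assms(1)[of "Im w"] show False
    by (simp add: eval_imag_axis_def map_poly_monic_poly)
qed

text \<open>With no roots on the axis, the roots in the open left half plane are exactly those not
  counted by \<open>rhp_count\<close>. The second count in \<open>q_unstable\<close> then follows
  from the first.\<close>

lemma q_unstable_monic_poly_iff:
  assumes "\<And>\<omega>. eval_imag_axis (monic_poly n c) \<omega> \<noteq> 0"
  shows "q_unstable q (monic_poly n c) \<longleftrightarrow> rhp_count (monic_poly n (\<lambda>j. complex_of_real (c j))) = q"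
proof -
  let ?p = "monic_poly n (\<lambda>j. complex_of_real (c j))"
  have "Re w \<noteq> 0" if "w \<in># proots ?p" for w
    using that assms by (intro imag_axis_root_free[of n c]) auto
  then have "filter_mset (\<lambda>z. Re z < 0) (proots ?p) = filter_mset (\<lambda>z. \<not> Re z > 0) (proots ?p)"
    by (intro filter_mset_cong) (auto simp: not_less order_less_le)
  moreover have "rhp_count ?p + size (filter_mset (\<lambda>z. \<not> Re z > 0) (proots ?p)) = n"
    unfolding rhp_count_def
    by (metis degree_monic_poly multiset_partition size_proots_complex size_union)
  ultimately show ?thesis
    by (auto simp: q_unstable_def map_poly_monic_poly coeff_monic_poly rhp_count_def)
qed

theorem lemma2p4:
  fixes n q :: nat and a b :: "nat \<Rightarrow> real" and Po :: "real poly"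
  assumes "\<And>j. j < n \<Longrightarrow> a j \<le> b j"
    and "a n = 1" and "b n = 1"
    and "Po \<in> interval_poly n a b" and "q_unstable q Po"
    and "\<And>\<omega>::real. \<omega> \<ge> 0 \<Longrightarrow>
      (Re (eval_imag_axis (corner_g1 n a b) \<omega>) * Re (eval_imag_axis (corner_g2 n a b) \<omega>),
       Im (eval_imag_axis (corner_h1 n a b) \<omega>) * Im (eval_imag_axis (corner_h2 n a b) \<omega>))
      \<notin> {(x, y). x \<le> 0 \<and> y \<le> 0}"
  shows "q_unstable_interval q (interval_poly n a b)"
  unfolding q_unstable_interval_def
proof
  fix P assume "P \<in> interval_poly n a b"
  then obtain c where c: "P = monic_poly n c" "\<And>j. j < n \<Longrightarrow> c j \<in> {a j..b j}"
    by (auto simp: interval_poly_def monic_poly_def)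
  obtain d where d: "Po = monic_poly n d" "\<And>j. j < n \<Longrightarrow> d j \<in> {a j..b j}"
    using assms(4) by (auto simp: interval_poly_def monic_poly_def)
  have nz: "eval_imag_axis (monic_poly n e) \<omega> \<noteq> 0" if e: "\<And>j. j < n \<Longrightarrow> e j \<in> {a j..b j}" for e \<omega>
  proof -
    \<comment> \<open>\<open>monic_poly\<close> reads \<open>e\<close> below \<open>n\<close> only,
      whereas the corner polynomials also use index \<open>n\<close>. The value 1 there lies in
      \<open>{a n..b n}\<close>.\<close>
    have "monic_poly n e = monic_poly n (e(n := 1))"
      by (rule poly_eqI) (simp add: coeff_monic_poly)
    moreover have "eval_imag_axis (monic_poly n (e(n := 1))) \<omega> \<noteq> 0"
    proof (rule eval_imag_axis_nonzero[OF _ _ assms(6)])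
      show "(e(n := 1)) j \<in> {a j..b j}" if "j \<le> n" for j
        using e[of j] that assms(2,3) by (cases "j = n") auto
    qed simp_all
    ultimately show ?thesis by simp
  qed
  \<comment> \<open>The segment from \<open>Po\<close> (at 0) to \<open>P\<close> (at 1); by
    convexity of the intervals it stays in the family.\<close>
  define s where "s t j = (1 - t) * d j + t * c j" for t :: real and j
  have s: "s t j \<in> {a j..b j}" if "t \<in> {0..1}" "j < n" for t j
    using convexD_alt[OF convex_real_interval(5), of "d j" "a j" "b j" "c j" t] c(2) d(2) that
    by (simp add: s_def)
  have "rhp_count (monic_poly n (\<lambda>j. complex_of_real (s 0 j)))
      = rhp_count (monic_poly n (\<lambda>j. complex_of_real (s 1 j)))"
  proof (rule rhp_count_constant[where T = "{0..1}" and c = "\<lambda>t j. complex_of_real (s t j)"])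
    show "continuous_on {0..1} (\<lambda>t. complex_of_real (s t j))" for j
      unfolding s_def by (intro continuous_intros)
    show "Re w \<noteq> 0" if "t \<in> {0..1}" "poly (monic_poly n (\<lambda>j. complex_of_real (s t j))) w = 0" for t w
      using imag_axis_root_free[of n "s t" w] nz[of "s t"] s that by blast
  qed auto
  then have "rhp_count (monic_poly n (\<lambda>j. complex_of_real (d j)))
      = rhp_count (monic_poly n (\<lambda>j. complex_of_real (c j)))"
    by (simp add: s_def)
  with assms(5) show "q_unstable q P"
    using q_unstable_monic_poly_iff nz[of c] nz[of d] c d by simp
qed

end
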